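(* Let $p\ge 2$ be an integer and let $\mathbf{c}=(c_n)_{n\ge 0}$ be a sequence with values in $\{-1,1\}$. Let $(F_n(x))_{n\ge 0}$ be a sequence of polynomials in $\mathbb{Z}[x]$, with arbitrary $F_0(x),F_1(x)\in\mathbb{Z}[x]$, satisfying for all $n\ge 2$ $$F_n(x)=F_{n-1}(x)+c_n\,x\,F_{n-2}(x),$$ and write $F_n(x)=\sum_{i\ge 0}a_{n,i}x^i$ with $a_{n,i}\in\mathbb{Z}$ for all $n\ge 0$. If the sequence $\mathbf{c}$ is $p$-automatic, then for every $i\ge 0$ and every integer $m\ge 2$, the sequence $(a_{n,i}\bmod m)_{n\ge 0}$ is $p$-automatic.
   Context: For an integer $k\ge2$, a sequence $(u_n)_{n\ge0}$ with values in a finite set is $k$-automatic if its $k$-kernel $\{(u_{k^in+j})_{n\ge0} : i\ge 0,\ 0\le j<k^i\}$ is a finite set. *)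

theory Defs
  imports "HOL-Computational_Algebra.Polynomial"
begin

definition kernel_seqs :: "nat \<Rightarrow> (nat \<Rightarrow> 'a) \<Rightarrow> (nat \<Rightarrow> 'a) set" where
  "kernel_seqs k u = {(\<lambda>n. u (k ^ i * n + j)) | i j. j < k ^ i}"

(* Only meaningful for bases k \<ge> 2; that bound is left to the statements using the notion. *)
definition automatic :: "nat \<Rightarrow> (nat \<Rightarrow> 'a) \<Rightarrow> bool" where
  "automatic k u \<longleftrightarrow> finite (range u) \<and> finite (kernel_seqs k u)"

end

theory Submission
  imports Defs "HOL-Library.FuncSet"
begin

text \<open>
  Comparing coefficients gives \<open>a\<^sub>n\<^sub>+\<^sub>2\<^sub>,\<^sub>i = a\<^sub>n\<^sub>+\<^sub>1\<^sub>,\<^sub>i + c\<^sub>n\<^sub>+\<^sub>2 a\<^sub>n\<^sub>,\<^sub>i\<^sub>-\<^sub>1\<close>, so up to a shift the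
  \<open>i\<close>-th coefficient sequence is the sequence of partial sums of a product of automatic sequences,
  and one concludes by induction on \<open>i\<close>. The essential point is that partial sums modulo \<open>m\<close> of an
  automatic sequence \<open>u\<close> are automatic: splitting \<open>{..<p\<^sup>e n + j}\<close> into blocks of length \<open>p\<^sup>e\<close> writes a
  kernel element as \<open>n \<mapsto> (\<Sum>k<n. A k) + B n\<close> modulo \<open>m\<close>, where \<open>A n\<close> and \<open>B n\<close> depend only on the
  values at \<open>n\<close> of the finitely many elements of the kernel of \<open>u\<close>. This leaves finitely many
  choices of \<open>A\<close> and \<open>B\<close>.
\<close>

lemma automatic_finite_range: "automatic k u \<Longrightarrow> finite (range u)"
  by (simp add: automatic_def)

lemma automatic_finite_kernel: "automatic k u \<Longrightarrow> finite (kernel_seqs k u)"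
  by (simp add: automatic_def)

lemma kernel_seqsI: "j < k ^ e \<Longrightarrow> (\<lambda>n. u (k ^ e * n + j)) \<in> kernel_seqs k u"
  by (auto simp: kernel_seqs_def)

lemma automatic_const: "automatic k (\<lambda>n. a)"
proof -
  have "kernel_seqs k (\<lambda>n. a) \<subseteq> {\<lambda>n. a}"
    by (auto simp: kernel_seqs_def)
  then show ?thesis
    by (auto simp: automatic_def intro: finite_subset)
qed

lemma automatic_map:
  assumes "automatic k u"
  shows "automatic k (\<lambda>n. f (u n))"
proof -
  have "kernel_seqs k (\<lambda>n. f (u n)) \<subseteq> (\<lambda>v n. f (v n)) ` kernel_seqs k u"
    by (fastforce simp: kernel_seqs_def)
  moreover have "range (\<lambda>n. f (u n)) = f ` range u"
    by auto
  ultimately show ?thesis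
    using assms by (auto simp: automatic_def intro: finite_subset)
qed

lemma automatic_map2:
  assumes "automatic k u" "automatic k v"
  shows "automatic k (\<lambda>n. f (u n) (v n))"
proof -
  have "kernel_seqs k (\<lambda>n. f (u n) (v n))
      \<subseteq> (\<lambda>(u', v') n. f (u' n) (v' n)) ` (kernel_seqs k u \<times> kernel_seqs k v)"
    by (fastforce simp: kernel_seqs_def)
  moreover have "range (\<lambda>n. f (u n) (v n)) \<subseteq> (\<lambda>(x, y). f x y) ` (range u \<times> range v)"
    by auto
  ultimately show ?thesis
    using assms unfolding automatic_def by (meson finite_SigmaI finite_imageI finite_subset)
qed

text \<open>The shift turns residue \<open>j\<close> into \<open>j + 1\<close>. This is again a
  residue unless \<open>j + 1 = k ^ e\<close>; then the carry yields residue \<open>0\<close> read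
  at \<open>n + 1\<close>, so shifts of kernel elements are added.\<close>

lemma automatic_Suc:
  assumes "automatic k u"
  shows "automatic k (\<lambda>n. u (Suc n))"
proof -
  let ?K = "kernel_seqs k u"
  have "kernel_seqs k (\<lambda>n. u (Suc n)) \<subseteq> ?K \<union> (\<lambda>v n. v (Suc n)) ` ?K"
  proof
    fix w assume "w \<in> kernel_seqs k (\<lambda>n. u (Suc n))"
    then obtain e j where w: "w = (\<lambda>n. u (Suc (k ^ e * n + j)))" and j: "j < k ^ e"
      by (auto simp: kernel_seqs_def)
    show "w \<in> ?K \<union> (\<lambda>v n. v (Suc n)) ` ?K"
    proof (cases "Suc j < k ^ e")
      case True
      then show ?thesis
        using kernel_seqsI[of "Suc j" k e u] w by simp
    next
      case False
      with j have "k ^ e = Suc j" by simp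
      then have "w = (\<lambda>n. (\<lambda>n. u (k ^ e * n + 0)) (Suc n))"
        by (simp add: w ac_simps)
      moreover have "(\<lambda>n. u (k ^ e * n + 0)) \<in> ?K"
        using j by (intro kernel_seqsI) linarith
      ultimately show ?thesis by (intro UnI2 image_eqI)
    qed
  qed
  moreover have "range (\<lambda>n. u (Suc n)) \<subseteq> range u"
    by auto
  ultimately show ?thesis
    using assms unfolding automatic_def by (meson finite_UnI finite_imageI finite_subset)
qed

text \<open>Dually, residue \<open>j > 0\<close> becomes \<open>j - 1\<close>, while residue
  \<open>0\<close> borrows: for \<open>n > 0\<close> it is the last residue read at
  \<open>n - 1\<close>. The value \<open>u 0\<close> is prepended by
  \<open>case_nat\<close>.\<close>

lemma automatic_of_Suc:
  assumes "automatic k (\<lambda>n. u (Suc n))"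
  shows "automatic k u"
proof -
  let ?K = "kernel_seqs k (\<lambda>n. u (Suc n))"
  have "kernel_seqs k u \<subseteq> ?K \<union> case_nat (u 0) ` ?K"
  proof
    fix w assume "w \<in> kernel_seqs k u"
    then obtain e j where w: "w = (\<lambda>n. u (k ^ e * n + j))" and j: "j < k ^ e"
      by (auto simp: kernel_seqs_def)
    show "w \<in> ?K \<union> case_nat (u 0) ` ?K"
    proof (cases j)
      case (Suc l)
      then show ?thesis
        using kernel_seqsI[of l k e "\<lambda>n. u (Suc n)"] w j by simp
    next
      case 0
      obtain l where l: "k ^ e = Suc l"
        using j by (cases "k ^ e") auto
      have "w = case_nat (u 0) (\<lambda>n. u (Suc (k ^ e * n + l)))"
        by (rule ext) (simp add: w 0 l ac_simps split: nat.split)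
      moreover have "(\<lambda>n. u (Suc (k ^ e * n + l))) \<in> ?K"
        using l by (intro kernel_seqsI[of l k e "\<lambda>n. u (Suc n)"]) simp
      ultimately show ?thesis by blast
    qed
  qed
  moreover have "range u \<subseteq> insert (u 0) (range (\<lambda>n. u (Suc n)))"
  proof
    fix x assume "x \<in> range u"
    then obtain n where "x = u n" by auto
    then show "x \<in> insert (u 0) (range (\<lambda>n. u (Suc n)))"
      by (cases n) auto
  qed
  ultimately show ?thesis
    using assms unfolding automatic_def
    by (meson finite_UnI finite_imageI finite_insert finite_subset)
qed

text \<open>Each such \<open>g\<close> factors through \<open>\<phi>\<close>, so it is determined by
  a map from the finite set \<open>range \<phi>\<close> to \<open>Y\<close>.\<close>

lemma finite_factoring_maps:
  assumes "finite (range \<phi>)" "finite Y"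
  shows "finite {g. range g \<subseteq> Y \<and> (\<forall>x y. \<phi> x = \<phi> y \<longrightarrow> g x = g y)}"
proof (rule finite_subset)
  show "{g. range g \<subseteq> Y \<and> (\<forall>x y. \<phi> x = \<phi> y \<longrightarrow> g x = g y)}
      \<subseteq> (\<lambda>h x. h (\<phi> x)) ` (range \<phi> \<rightarrow>\<^sub>E Y)"
  proof
    fix g assume "g \<in> {g. range g \<subseteq> Y \<and> (\<forall>x y. \<phi> x = \<phi> y \<longrightarrow> g x = g y)}"
    then have ran: "range g \<subseteq> Y" and resp: "\<And>x y. \<phi> x = \<phi> y \<Longrightarrow> g x = g y"
      by blast+
    \<comment> \<open>\<open>inv \<phi>\<close> picks a representative of each fibre;
      \<open>restrict\<close> puts the factor into the finite extensional function space.\<close>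
    let ?h = "restrict (\<lambda>z. g (inv \<phi> z)) (range \<phi>)"
    have "g = (\<lambda>x. ?h (\<phi> x))"
    proof
      fix x
      show "g x = ?h (\<phi> x)"
        using resp[of x "inv \<phi> (\<phi> x)"] by (simp add: f_inv_into_f)
    qed
    moreover have "?h \<in> range \<phi> \<rightarrow>\<^sub>E Y"
      using ran by auto
    ultimately show "g \<in> (\<lambda>h x. h (\<phi> x)) ` (range \<phi> \<rightarrow>\<^sub>E Y)" by blast
  qed
qed (use assms in \<open>auto intro!: finite_PiE\<close>)

lemma sum_lessThan_mult_add:
  fixes f :: "nat \<Rightarrow> 'a::comm_monoid_add"
  shows "(\<Sum>t<q * n + j. f t) = (\<Sum>s<n. \<Sum>r<q. f (q * s + r)) + (\<Sum>r<j. f (q * n + r))"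
proof -
  have split: "(\<Sum>t<a + b. f t) = (\<Sum>t<a. f t) + (\<Sum>t<b. f (a + t))" for a b
    by (induction b) (auto simp: add.assoc)
  have "(\<Sum>t<q * n. f t) = (\<Sum>s<n. \<Sum>r<q. f (q * s + r))"
    by (induction n) (simp_all add: split[of _ q] add.commute[of q])
  then show ?thesis by (simp add: split)
qed

lemma automatic_partial_sums_mod:
  fixes u :: "nat \<Rightarrow> int"
  assumes u: "automatic k u" and m: "m > 0"
  shows "automatic k (\<lambda>n. (\<Sum>t<n. u t) mod m)"
proof -
  let ?K = "kernel_seqs k u"
  \<comment> \<open>\<open>\<phi> n\<close> records the values at \<open>n\<close> of all kernel
    elements at once. \<open>G\<close> is the finite pool for the sequences \<open>A\<close> and
    \<open>B\<close>.\<close>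
  define \<phi> where "\<phi> n = restrict (\<lambda>w. w n) ?K" for n
  define G where "G = {g. range g \<subseteq> {0..<m} \<and> (\<forall>x y. \<phi> x = \<phi> y \<longrightarrow> g x = g y)}"
  have "range \<phi> \<subseteq> ?K \<rightarrow>\<^sub>E range u"
    by (auto simp: \<phi>_def kernel_seqs_def[of k u] intro!: restrict_PiE_iff[THEN iffD2])
  moreover have "finite (?K \<rightarrow>\<^sub>E range u)"
    using automatic_finite_range[OF u] automatic_finite_kernel[OF u] by (intro finite_PiE) auto
  ultimately have "finite (range \<phi>)"
    by (rule finite_subset)
  then have "finite G"
    unfolding G_def by (rule finite_factoring_maps) simp
  \<comment> \<open>The bound is not strict because \<open>j = k ^ e\<close>, a full block, is the
    case that gives \<open>A\<close>.\<close>
  have block: "(\<lambda>n. (\<Sum>r<j. u (k ^ e * n + r)) mod m) \<in> G" if "j \<le> k ^ e" for e j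
  proof -
    have eq: "u (k ^ e * x + r) = u (k ^ e * y + r)" if "\<phi> x = \<phi> y" "r < j" for x y r
    proof -
      have "(\<lambda>n. u (k ^ e * n + r)) \<in> ?K"
        using \<open>r < j\<close> \<open>j \<le> k ^ e\<close> by (intro kernel_seqsI) simp
      then show ?thesis
        using fun_cong[OF \<open>\<phi> x = \<phi> y\<close>, of "\<lambda>n. u (k ^ e * n + r)"] by (simp add: \<phi>_def)
    qed
    have "(\<Sum>r<j. u (k ^ e * x + r)) = (\<Sum>r<j. u (k ^ e * y + r))" if "\<phi> x = \<phi> y" for x y
      by (intro sum.cong refl eq[OF that]) simp
    then have "\<forall>x y. \<phi> x = \<phi> y
        \<longrightarrow> (\<Sum>r<j. u (k ^ e * x + r)) mod m = (\<Sum>r<j. u (k ^ e * y + r)) mod m"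
      by metis
    moreover have "range (\<lambda>n. (\<Sum>r<j. u (k ^ e * n + r)) mod m) \<subseteq> {0..<m}"
      using m by auto
    ultimately show ?thesis
      unfolding G_def by blast
  qed
  have "kernel_seqs k (\<lambda>n. (\<Sum>t<n. u t) mod m)
      \<subseteq> (\<lambda>(A, B) n. ((\<Sum>s<n. A s) + B n) mod m) ` (G \<times> G)"
  proof
    fix w assume "w \<in> kernel_seqs k (\<lambda>n. (\<Sum>t<n. u t) mod m)"
    then obtain e j where w: "w = (\<lambda>n. (\<Sum>t<k ^ e * n + j. u t) mod m)" and j: "j < k ^ e"
      by (auto simp: kernel_seqs_def)
    \<comment> \<open>Reducing each block modulo \<open>m\<close> keeps \<open>A\<close> and
      \<open>B\<close> within the finite set of values demanded by \<open>G\<close>, without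
      changing the total modulo \<open>m\<close>.\<close>
    define A where "A n = (\<Sum>r<k ^ e. u (k ^ e * n + r)) mod m" for n
    define B where "B n = (\<Sum>r<j. u (k ^ e * n + r)) mod m" for n
    have "A \<in> G" "B \<in> G"
      using block[of "k ^ e" e] block[of j e] j by (simp_all add: A_def[abs_def] B_def[abs_def])
    moreover have "w = (\<lambda>n. ((\<Sum>s<n. A s) + B n) mod m)"
    proof
      fix n
      have "w n = (((\<Sum>s<n. \<Sum>r<k ^ e. u (k ^ e * s + r)) mod m) + B n) mod m"
        by (simp add: w B_def sum_lessThan_mult_add mod_simps)
      also have "(\<Sum>s<n. \<Sum>r<k ^ e. u (k ^ e * s + r)) mod m = (\<Sum>s<n. A s) mod m"
        unfolding A_def by (rule mod_sum_eq[symmetric])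
      finally show "w n = ((\<Sum>s<n. A s) + B n) mod m"
        by (simp add: mod_simps)
    qed
    ultimately show "w \<in> (\<lambda>(A, B) n. ((\<Sum>s<n. A s) + B n) mod m) ` (G \<times> G)"
      by (intro image_eqI[of _ _ "(A, B)"]) auto
  qed
  then have "finite (kernel_seqs k (\<lambda>n. (\<Sum>t<n. u t) mod m))"
    by (rule finite_subset) (simp add: \<open>finite G\<close>)
  moreover have "range (\<lambda>n. (\<Sum>t<n. u t) mod m) \<subseteq> {0..<m}"
    using m by auto
  ultimately show ?thesis
    by (auto simp: automatic_def intro: finite_subset)
qed

theorem proposition3p1:
  fixes p :: nat and c :: "nat \<Rightarrow> int" and F :: "nat \<Rightarrow> int poly"
  assumes "p \<ge> 2"
    and "\<And>n. c n \<in> {-1, 1}"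
    and "\<And>n. n \<ge> 2 \<Longrightarrow> F n = F (n - 1) + smult (c n) ([:0, 1:] * F (n - 2))"
    and "automatic p c"
  shows "\<forall>i::nat. \<forall>m::int. m \<ge> 2 \<longrightarrow> automatic p (\<lambda>n. coeff (F n) i mod m)"
proof (intro allI impI)
  fix i :: nat and m :: int
  assume m: "m \<ge> 2"
  have rec: "F (Suc (Suc n)) = F (Suc n) + smult (c (Suc (Suc n))) (pCons 0 (F n))" for n
    using assms(3)[of "Suc (Suc n)"] by simp
  show "automatic p (\<lambda>n. coeff (F n) i mod m)"
  proof (induction i)
    case 0
    \<comment> \<open>The term with factor \<open>x\<close> has no constant coefficient. Constancy
      starts only at index 1, as \<open>F 0\<close> and \<open>F 1\<close> are unrelated.\<close>
    have "coeff (F (Suc n)) 0 = coeff (F 1) 0" for n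
      by (induction n) (simp_all add: rec)
    then have "automatic p (\<lambda>n. coeff (F (Suc n)) 0 mod m)"
      by (simp only: automatic_const)
    then show ?case by (rule automatic_of_Suc)
  next
    case (Suc i)
    \<comment> \<open>\<open>u n\<close> is, modulo \<open>m\<close>, the increment of coefficient
      \<open>Suc i\<close> from \<open>F (Suc n)\<close> to \<open>F (Suc (Suc n))\<close>. Reducing
      the coefficient of \<open>F n\<close> makes the induction hypothesis applicable.\<close>
    define u where "u n = c (Suc (Suc n)) * (coeff (F n) i mod m)" for n
    have "automatic p u"
      unfolding u_def using Suc automatic_Suc[OF automatic_Suc[OF assms(4)]]
      by (intro automatic_map2[where f = "(*)"])
    then have "automatic p (\<lambda>n. (\<Sum>t<n. u t) mod m)"
      using m by (intro automatic_partial_sums_mod) auto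
    then have "automatic p (\<lambda>n. (coeff (F 1) (Suc i) + (\<Sum>t<n. u t) mod m) mod m)"
      by (rule automatic_map)
    \<comment> \<open>Telescoping starts from \<open>F 1\<close>, since the recurrence first
      produces \<open>F 2\<close>; index 0 is restored at the end by
      \<open>automatic_of_Suc\<close>.\<close>
    moreover have "coeff (F (Suc n)) (Suc i) mod m
        = (coeff (F 1) (Suc i) + (\<Sum>t<n. u t) mod m) mod m" for n
    proof (induction n)
      case 0
      show ?case by simp
    next
      case (Suc n)
      have "coeff (F (Suc (Suc n))) (Suc i) mod m
          = (coeff (F (Suc n)) (Suc i) mod m + u n) mod m"
        by (simp add: rec u_def mod_simps) (metis mod_add_right_eq mod_mult_right_eq)
      also have "\<dots> = (coeff (F 1) (Suc i) + (\<Sum>t<Suc n. u t) mod m) mod m"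
        by (simp add: Suc mod_simps add.assoc)
      finally show ?case .
    qed
    ultimately have "automatic p (\<lambda>n. coeff (F (Suc n)) (Suc i) mod m)"
      by simp
    then show ?case by (rule automatic_of_Suc)
  qed
qed

end
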